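(* Let $(X,d)$ be a metric space and $p\ge1$. Then $\sqrt{H_p}$ is a metric on the cone $\mathfrak{C}$ over $X$, where $H_p$ is the marginal perspective cost induced by the entropy $U_p$ and the cost $c=d^2$, explicitly $$H_p(x_1,r;x_2,t)=\frac{2}{p}\Big[\mathfrak{M}_1(r,t)-\mathfrak{M}_{1-p}(r,t)\Big(1-(p-1)\frac{d^2(x_1,x_2)}{2}\Big)_+^{\frac{p}{p-1}}\Big]\quad(p>1),$$ $$H_1(x_1,r;x_2,t)=2\Big[\mathfrak{M}_1(r,t)-\mathfrak{M}_0(r,t)e^{-d^2(x_1,x_2)/2}\Big].$$ That is: $H_p(x_1,r;x_2,t)$ depends only on the equivalence classes of $(x_1,r)$ and $(x_2,t)$ in $\mathfrak C$, it vanishes iff these classes coincide, it is symmetric, and $\sqrt{H_p(x_1,r;x_3,t)}\le\sqrt{H_p(x_1,r;x_2,s)}+\sqrt{H_p(x_2,s;x_3,t)}$ for all $x_1,x_2,x_3\in X$, $r,s,t\ge0$.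
   Context: Power means: for $r,t\ge0$ and $q\neq0$, $\mathfrak{M}_q(r,t)=\big(\frac{r^q+t^q}{2}\big)^{1/q}$, except $\mathfrak{M}_q(r,t)=0$ when $q<0$ and $r=0$ or $t=0$; $\mathfrak{M}_0(r,t)=\sqrt{rt}$. $(y)_+=\max(y,0)$. Power-like entropy: $U_p(s)=\frac{1}{p(p-1)}(s^p-p(s-1)-1)$ for $p\neq0,1$, $U_1(s)=s\ln s-s+1$. The induced marginal perspective cost is $H(x_1,r_1;x_2,r_2)=H_{c(x_1,x_2)}(r_1,r_2)$ where $H_c$ is the lower semicontinuous envelope of $(r_1,r_2)\mapsto\inf_{\theta>0}[r_1F(\theta/r_1)+r_2F(\theta/r_2)+\theta c]$ (with the perspective convention at $r_i=0$); for $F=U_p$, $c=d^2$ it equals the displayed formulas. The cone over $X$ is $\mathfrak C=(X\times[0,\infty))/\sim$ with $(x_1,r_1)\sim(x_2,r_2)$ iff $r_1=r_2=0$, or $r_1=r_2$ and $x_1=x_2$. *)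

theory Defs
  imports "HOL-Analysis.Analysis"
begin

definition powmean :: "real \<Rightarrow> real \<Rightarrow> real \<Rightarrow> real" where
  "powmean q r t =
     (if q = 0 then sqrt (r * t)
      else if q < 0 \<and> (r = 0 \<or> t = 0) then 0
      else ((r powr q + t powr q) / 2) powr (1 / q))"

definition posp :: "real \<Rightarrow> real" where
  "posp y = max y 0"

text \<open>Marginal perspective cost H_p induced by U_p and c = d^2 (explicit formula), p >= 1.\<close>
definition Hp :: "real \<Rightarrow> 'a::metric_space \<Rightarrow> real \<Rightarrow> 'a \<Rightarrow> real \<Rightarrow> real" where
  "Hp p x1 r x2 t =
     (if p = 1 then 2 * (powmean 1 r t - powmean 0 r t * exp (- (dist x1 x2)\<^sup>2 / 2))
      else (2 / p) * (powmean 1 r t - powmean (1 - p) r t *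
              (posp (1 - (p - 1) * (dist x1 x2)\<^sup>2 / 2)) powr (p / (p - 1))))"

definition cone_eq :: "'a \<Rightarrow> real \<Rightarrow> 'a \<Rightarrow> real \<Rightarrow> bool" where
  "cone_eq x1 r1 x2 r2 \<longleftrightarrow> (r1 = 0 \<and> r2 = 0) \<or> (r1 = r2 \<and> x1 = x2)"

end

theory Submission
  imports Defs "HOL-Real_Asymp.Real_Asymp"
begin

text \<open>
  Put \<open>q = p - 1\<close> and rescale the distances so that \<open>H_p\<close> is, up to the factor \<open>2/p\<close>,
  \<open>(r + t)/2 - K(r,t)\<close> with \<open>K(r,t) = M(r,t) (1 - a^2)_+^((q+1)/q)\<close> and \<open>M\<close> the power mean
  of exponent \<open>-q\<close>. The triangle inequality for the square roots is equivalent to the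
  non-negativity, for every \<open>0 < l < 1\<close>, of the quadratic form of \<open>K\<close> on three points with the
  coefficients \<open>(1 - l, -1, l)\<close>.

  For \<open>a = 0\<close> this holds because \<open>M\<close> is a positive semidefinite kernel. The kernel \<open>K\<close> itself is
  in general not positive semidefinite. The case of positive distances is reduced to \<open>a = 0\<close> by
  the variational formula \<open>q K(r,t) = max_w (q + 1) w (1 - a^2) - w^(q+1) (r^-q + t^-q)/2\<close>:
  fix the maximisers \<open>w1, w2\<close> for the two short sides and minimise over the masses. With the test value
  \<open>w\<close> for the long side determined by \<open>balanced_split_powr\<close>, the minimising masses
  \<open>r', t'\<close> satisfy \<open>w = M(r',t')\<close>, the distances drop out by Cauchy-Schwarz, and what remains is the
  case \<open>a = 0\<close> for the minimising masses. The case \<open>p = 1\<close> is the limit \<open>p \<rightarrow> 1\<close>.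
\<close>

section \<open>Positive semidefiniteness of negative powers of arithmetic means\<close>

lemma powr_mean_kernel_psd:
  fixes c X :: "'i \<Rightarrow> real" and \<beta> :: real
  assumes X: "\<And>i. i \<in> I \<Longrightarrow> X i > 0" and \<beta>: "\<beta> > 0"
  shows "(\<Sum>i\<in>I. \<Sum>j\<in>I. c i * c j * ((X i + X j) / 2) powr (-\<beta>)) \<ge> 0"
proof -
  \<comment> \<open>This substitution turns the kernel into \<open>(1 - \<xi>\<^sub>i \<xi>\<^sub>j)\<^sup>-\<^sup>\<beta>\<close> up to a rank-one factor;
    its binomial series has non-negative coefficients.\<close>
  define \<xi> where "\<xi> i = (1 - X i) / (1 + X i)" for i
  define C where "C n = pochhammer \<beta> n / fact n" for n :: nat
  have C: "C n \<ge> 0" for n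
    using \<beta> by (simp add: C_def pochhammer_nonneg)
  have \<xi>: "\<bar>\<xi> i\<bar> < 1" "1 + \<xi> i > 0" if "i \<in> I" for i
    using X[OF that] by (auto simp: \<xi>_def field_simps abs_less_iff)
  have entry: "(\<lambda>n. C n * (c i * (1 + \<xi> i) powr \<beta> * \<xi> i ^ n) * (c j * (1 + \<xi> j) powr \<beta> * \<xi> j ^ n))
      sums (c i * c j * ((X i + X j) / 2) powr (-\<beta>))" if i: "i \<in> I" and j: "j \<in> I" for i j
  proof -
    have lt: "\<bar>- (\<xi> i * \<xi> j)\<bar> < 1"
      using abs_mult_less[OF \<xi>(1)[OF i] \<xi>(1)[OF j]] by (simp add: abs_mult)
    have eq: "(X i + X j) / 2 = (1 - \<xi> i * \<xi> j) / ((1 + \<xi> i) * (1 + \<xi> j))"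
      using X[OF i] X[OF j] by (simp add: \<xi>_def divide_simps) (simp add: algebra_simps)
    have pos: "1 - \<xi> i * \<xi> j > 0" using lt by (simp add: abs_less_iff)
    have "((X i + X j) / 2) powr (-\<beta>)
        = (1 + \<xi> i) powr \<beta> * (1 + \<xi> j) powr \<beta> * (1 - \<xi> i * \<xi> j) powr (-\<beta>)"
      unfolding eq using pos \<xi>(2)[OF i] \<xi>(2)[OF j]
      by (simp add: powr_divide powr_mult powr_minus_divide)
    moreover have series: "(\<lambda>n. C n * (\<xi> i ^ n * \<xi> j ^ n)) sums ((1 - \<xi> i * \<xi> j) powr (-\<beta>))"
    proof -
      \<comment> \<open>The sign \<open>(-1)^n\<close> in the binomial coefficient of the negative
        exponent \<open>-\<beta>\<close> cancels the sign of
        \<open>(- (\<xi> i * \<xi> j)) ^ n\<close>, which leaves the non-negative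
        \<open>C n\<close>.\<close>
      have "C n * (\<xi> i ^ n * \<xi> j ^ n) = (-\<beta> gchoose n) * (- (\<xi> i * \<xi> j)) ^ n" for n
        by (simp add: C_def gbinomial_pochhammer power_mult_distrib power_minus[of "\<xi> i * \<xi> j"])
      then show ?thesis using gen_binomial_real[OF lt, of "-\<beta>"] by simp
    qed
    ultimately show ?thesis
      using sums_mult[OF series, of "c i * c j * ((1 + \<xi> i) powr \<beta> * (1 + \<xi> j) powr \<beta>)"]
      by (simp only: mult_ac)
  qed
  have series: "(\<lambda>n. \<Sum>i\<in>I. \<Sum>j\<in>I. C n * (c i * (1 + \<xi> i) powr \<beta> * \<xi> i ^ n) * (c j * (1 + \<xi> j) powr \<beta> * \<xi> j ^ n))
      sums (\<Sum>i\<in>I. \<Sum>j\<in>I. c i * c j * ((X i + X j) / 2) powr (-\<beta>))"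
    by (intro sums_sum entry)
  have square: "(\<Sum>i\<in>I. \<Sum>j\<in>I. C n * (c i * (1 + \<xi> i) powr \<beta> * \<xi> i ^ n) * (c j * (1 + \<xi> j) powr \<beta> * \<xi> j ^ n))
      = C n * (\<Sum>i\<in>I. c i * (1 + \<xi> i) powr \<beta> * \<xi> i ^ n)\<^sup>2" for n
    by (simp add: power2_eq_square sum_product sum_distrib_left mult_ac)
  show ?thesis
    by (rule sums_le[OF _ sums_zero series]) (simp add: square C)
qed

section \<open>Young's inequality as a variational formula\<close>

text \<open>Young's inequality with the conjugate exponents \<open>q + 1\<close> and
  \<open>(q + 1) / q\<close>, after \<open>N\<close> is split into two reciprocal factors
  \<open>N powr (1/(q+1))\<close> and \<open>N powr (-(1/(q+1)))\<close> that leave the product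
  \<open>w * y\<close> unchanged. For \<open>N = (r powr (-q) + t powr (-q)) / 2\<close> the factor
  \<open>N powr (-(1/q))\<close> is the power mean.\<close>

lemma young_powr:
  fixes q w N y :: real
  assumes q: "q > 0" and "w \<ge> 0" "N > 0" "y \<ge> 0"
  shows "(q + 1) * w * y \<le> w powr (q + 1) * N + q * (N powr (-(1/q)) * y powr ((q + 1) / q))"
proof -
  have "(w * N powr (1/(q+1))) * (y * N powr (-(1/(q+1))))
     \<le> (w * N powr (1/(q+1))) powr (q+1) / (q+1)
       + (y * N powr (-(1/(q+1)))) powr ((q+1)/q) / ((q+1)/q)"
    using assms by (intro Youngs_inequality) (auto simp: field_simps)
  also have "(w * N powr (1/(q+1))) powr (q+1) = w powr (q+1) * N"
    using assms by (simp add: powr_mult powr_powr)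
  also have "(y * N powr (-(1/(q+1)))) powr ((q+1)/q) = N powr (-(1/q)) * y powr ((q+1)/q)"
    using assms by (simp add: powr_mult powr_powr)
  also have "(w * N powr (1/(q+1))) * (y * N powr (-(1/(q+1)))) = w * y"
    using assms by (simp add: powr_minus field_simps)
  finally have "(q+1) * (w * y) \<le> (q+1) * (w powr (q+1) * N / (q+1)
       + N powr (-(1/q)) * y powr ((q+1)/q) / ((q+1)/q))"
    using q by (intro mult_left_mono) auto
  also have "\<dots> = w powr (q+1) * N + q * (N powr (-(1/q)) * y powr ((q+1)/q))"
    using q by (simp add: distrib_left)
  finally show ?thesis by (simp add: mult_ac)
qed

text \<open>The equality case: differentiating in \<open>w\<close> gives the maximiser
  \<open>w powr q = y / N\<close>, which is positive because \<open>y\<close> is.\<close>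

lemma young_powr_attained:
  fixes q N y :: real
  assumes q: "q > 0" and N: "N > 0" and y: "y > 0"
  obtains w where "w > 0"
    and "q * (N powr (-(1/q)) * y powr ((q + 1) / q)) = (q + 1) * w * y - w powr (q + 1) * N"
proof
  define w where "w = (y / N) powr (1/q)"
  show "w > 0" using assms by (simp add: w_def)
  have e: "(q + 1) / q = 1 / q + 1" using q by (simp add: field_simps)
  have "N powr (-(1/q)) * y powr ((q + 1) / q) = w * y"
    unfolding w_def e powr_add using assms by (simp add: powr_divide powr_minus_divide)
  moreover have "w powr (q + 1) * N = w * y"
  proof -
    have "w powr q = y / N" using assms by (simp add: w_def powr_powr)
    then show ?thesis using \<open>w > 0\<close> N by (simp add: powr_add field_simps)
  qed
  ultimately show "q * (N powr (-(1/q)) * y powr ((q + 1) / q)) = (q + 1) * w * y - w powr (q + 1) * N"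
    by (simp add: algebra_simps)
qed

text \<open>As a function of \<open>r\<close> the right side is minimal at
  \<open>r = \<rho>\<close>, with value \<open>(q + 1) * \<rho>\<close>. This carries out the
  minimisation over a single mass.\<close>

lemma young_powr_neg:
  fixes q r \<rho> :: real
  assumes "q > 0" "r > 0" "\<rho> \<ge> 0"
  shows "(q + 1) * \<rho> \<le> q * r + \<rho> powr (q + 1) * r powr (-q)"
  using young_powr[of q \<rho> "r powr (-q)" 1] assms by (simp add: powr_powr)

section \<open>Comparison of power means\<close>

text \<open>The AM-GM inequality for \<open>r powr (-q)\<close> and \<open>t powr (-q)\<close>; the
  decreasing power \<open>-q\<close> reverses it.\<close>

lemma powr_mean_neg_le_geometric:
  fixes q r t w :: real
  assumes q: "q > 0" and "r > 0" "t > 0" "w > 0"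
    and w: "w powr (-q) = (r powr (-q) + t powr (-q)) / 2"
  shows "w \<le> sqrt (r * t)"
proof -
  have "(r * t) powr (-q) = r powr (-q) * t powr (-q)"
    using assms by (simp add: powr_mult)
  then have "sqrt (r * t) powr (-q) = sqrt (r powr (-q) * t powr (-q))"
    using assms by (metis mult_pos_pos order_less_imp_le powr_ge_zero powr_half_sqrt powr_powr mult.commute)
  also have "\<dots> \<le> w powr (-q)"
    unfolding w by (rule arith_geo_mean_sqrt) auto
  finally have "sqrt (r * t) powr (-q) \<le> w powr (-q)" .
  show ?thesis
  proof (rule ccontr)
    assume "\<not> w \<le> sqrt (r * t)"
    then have "w powr (-q) < sqrt (r * t) powr (-q)"
      using assms by (intro powr_less_mono2_neg) auto
    with \<open>sqrt (r * t) powr (-q) \<le> w powr (-q)\<close> show False by simp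
  qed
qed

lemma powr_mean_ge_arithmetic:
  fixes p l x y w :: real
  assumes "p \<ge> 1" "0 < l" "l < 1" "x > 0" "y > 0" "w > 0"
    and w: "w powr p = (1 - l) * x powr p + l * y powr p"
  shows "(1 - l) * x + l * y \<le> w"
proof -
  have "((1 - l) * x + l * y) powr p \<le> w powr p"
    unfolding w using convex_onD[OF powr_convex[OF \<open>p \<ge> 1\<close>], of l x y] assms by simp
  then show ?thesis
    using assms powr_less_mono2[of p w "(1 - l) * x + l * y"] by fastforce
qed

section \<open>Finding the test value for the long side\<close>

text \<open>The two linear equations determine \<open>P\<close> and \<open>Q\<close> from
  \<open>v\<close>; the last equation says that \<open>v powr e\<close> is the harmonic mean of
  \<open>P powr e\<close> and \<open>Q powr e\<close>. The intermediate value theorem in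
  \<open>v\<close> solves it, and \<open>A \<le> B\<close> supplies the signs at the
  endpoints.\<close>

lemma balanced_split_ordered:
  fixes A B l e :: real
  assumes "0 < A" "A \<le> B" and l: "0 < l" "l < 1" and e: "e > 0"
  obtains P Q v where "P > 0" "Q > 0" "v > 0" "A = (1 - l) * P + l * v" "B = l * Q + (1 - l) * v"
    "2 * P powr e * Q powr e = v powr e * (P powr e + Q powr e)"
proof -
  define P where "P v = (A - l * v) / (1 - l)" for v
  define Q where "Q v = (B - (1 - l) * v) / l" for v
  define h where "h v = 2 * P v powr e * Q v powr e - v powr e * (P v powr e + Q v powr e)" for v
  \<comment> \<open>The bound \<open>A / l\<close> keeps \<open>P\<close> non-negative, and the
    bound \<open>B\<close> keeps \<open>Q\<close> positive. At either value the defect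
    \<open>h\<close> is at most 0.\<close>
  define m where "m = min B (A / l)"
  have Am: "A \<le> m" using assms by (simp add: m_def field_simps)
  have bounds: "v > 0" "P v \<ge> 0" "Q v > 0" if "A \<le> v" "v \<le> m" for v
  proof -
    show "v > 0" using that assms by simp
    show "P v \<ge> 0" using that l by (simp add: P_def m_def field_simps)
    have "(1 - l) * v < v" using \<open>v > 0\<close> l by (simp add: algebra_simps)
    also have "v \<le> B" using that by (simp add: m_def)
    finally show "Q v > 0" using l by (simp add: Q_def)
  qed
  have PA: "P A = A" using l by (simp add: P_def field_simps)
  have "A \<le> Q A"
    using assms by (simp add: Q_def field_simps)
  then have "A powr e \<le> Q A powr e" using assms by (intro powr_mono2) auto
  then have hA: "h A \<ge> 0"
    using assms mult_left_mono[of "A powr e" "Q A powr e" "A powr e"] by (simp add: h_def PA algebra_simps)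
  have hm: "h m \<le> 0"
  proof (cases "B \<le> A / l")
    case True
    then have m: "m = B" by (simp add: m_def)
    have QB: "Q B = B" using l by (simp add: Q_def field_simps)
    have "P B \<le> B" using assms l by (simp add: P_def field_simps)
    then have "P B powr e \<le> B powr e" using bounds(2)[of B] Am m assms by (intro powr_mono2) auto
    then show ?thesis
      using mult_left_mono[of "P B powr e" "B powr e" "B powr e"] by (simp add: h_def m QB algebra_simps)
  next
    case False
    then have "m = A / l" by (simp add: m_def)
    then have "P m = 0" using l by (simp add: P_def)
    then show ?thesis using e by (simp add: h_def)
  qed
  have cont: "continuous_on {A..m} P" "continuous_on {A..m} Q"
    unfolding P_def Q_def using l by (auto intro!: continuous_intros)
  have "continuous_on {A..m} h"
    unfolding h_def
    by (intro continuous_on_diff continuous_on_mult continuous_on_add continuous_on_const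
        continuous_on_id continuous_on_powr' cont ballI) (use bounds e in \<open>auto simp: less_imp_le\<close>)
  \<comment> \<open>\<open>P\<close> may vanish at the endpoint \<open>m\<close>, but not at a zero of \<open>h\<close>.\<close>
  then obtain v where v: "A \<le> v" "v \<le> m" "h v = 0"
    using IVT2'[of h m 0 A] hA hm Am by auto
  have "P v \<noteq> 0"
  proof
    assume "P v = 0"
    then have "h v = - (v powr e * Q v powr e)" using e by (simp add: h_def)
    also have "\<dots> < 0" using bounds[OF v(1,2)] by simp
    finally show False using v(3) by simp
  qed
  then have "P v > 0" using bounds(2)[OF v(1,2)] by simp
  show thesis
  proof (rule that)
    show "A = (1 - l) * P v + l * v" "B = l * Q v + (1 - l) * v"
      using l by (auto simp: P_def Q_def field_simps)
    show "2 * P v powr e * Q v powr e = v powr e * (P v powr e + Q v powr e)"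
      using v(3) by (simp add: h_def)
  qed (use bounds[OF v(1,2)] \<open>P v > 0\<close> in simp_all)
qed

lemma balanced_split:
  fixes A B l e :: real
  assumes "0 < A" "0 < B" and l: "0 < l" "l < 1" and e: "e > 0"
  obtains P Q v where "P > 0" "Q > 0" "v > 0" "A = (1 - l) * P + l * v" "B = l * Q + (1 - l) * v"
    "2 * P powr e * Q powr e = v powr e * (P powr e + Q powr e)"
proof (cases "A \<le> B")
  case True
  then show thesis using balanced_split_ordered[of A B l e] that assms by blast
next
  case False
  then obtain Q P v where "Q > 0" "P > 0" "v > 0" "B = (1 - (1 - l)) * Q + (1 - l) * v"
    "A = (1 - l) * P + (1 - (1 - l)) * v"
    "2 * Q powr e * P powr e = v powr e * (Q powr e + P powr e)"
    using balanced_split_ordered[of B A "1 - l" e] assms by auto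
  then show thesis by (intro that[of P Q v]) (auto simp: algebra_simps)
qed

text \<open>The substitution \<open>P = r powr (q+1)\<close>, \<open>Q = t powr (q+1)\<close>,
  \<open>v = w powr (q+1)\<close> with \<open>e = q/(q+1)\<close> turns \<open>P powr e\<close> into
  \<open>r powr q\<close>, so the harmonic mean condition becomes the power mean condition on
  \<open>w\<close>.\<close>

lemma balanced_split_powr:
  fixes q l w1 w2 :: real
  assumes q: "q > 0" and l: "0 < l" "l < 1" and w: "w1 > 0" "w2 > 0"
  obtains r t w where "r > 0" "t > 0" "w > 0"
    and "w1 powr (q + 1) = (1 - l) * r powr (q + 1) + l * w powr (q + 1)"
    and "w2 powr (q + 1) = l * t powr (q + 1) + (1 - l) * w powr (q + 1)"
    and "w powr (-q) = (r powr (-q) + t powr (-q)) / 2"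
proof -
  obtain P Q v where *: "P > 0" "Q > 0" "v > 0"
    and A: "w1 powr (q + 1) = (1 - l) * P + l * v"
    and B: "w2 powr (q + 1) = l * Q + (1 - l) * v"
    and eq: "2 * P powr (q/(q+1)) * Q powr (q/(q+1)) = v powr (q/(q+1)) * (P powr (q/(q+1)) + Q powr (q/(q+1)))"
    using balanced_split[of "w1 powr (q + 1)" "w2 powr (q + 1)" l "q/(q+1)"] assms by auto
  have root: "(x powr (1/(q+1))) powr (q+1) = x" "(x powr (1/(q+1))) powr (-q) = inverse (x powr (q/(q+1)))"
    if "x > 0" for x
    using that q by (auto simp: powr_powr simp flip: powr_minus)
  have pos: "P powr (q/(q+1)) > 0" "Q powr (q/(q+1)) > 0" "v powr (q/(q+1)) > 0" using * by auto
  have mean: "inverse (v powr (q/(q+1))) = (inverse (P powr (q/(q+1))) + inverse (Q powr (q/(q+1)))) / 2"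
    using pos eq by (simp add: divide_simps) (simp add: algebra_simps)
  show thesis
    by (rule that[of "P powr (1/(q+1))" "Q powr (1/(q+1))" "v powr (1/(q+1))"])
       (use * A B mean in \<open>simp_all add: root\<close>)
qed

section \<open>The three-point inequality at distance zero\<close>

lemma powmean_neg:
  assumes "q > 0" "r > 0" "t > 0"
  shows "powmean (-q) r t = ((r powr (-q) + t powr (-q)) / 2) powr (-(1/q))"
  using assms by (simp add: powmean_def)

lemma powmean_neg_eqI:
  fixes q r t w :: real
  assumes "q > 0" "r > 0" "t > 0" "w > 0" "w powr (-q) = (r powr (-q) + t powr (-q)) / 2"
  shows "powmean (-q) r t = w"
  unfolding powmean_neg[OF assms(1-3)] assms(5)[symmetric] using assms(1,4) by (simp add: powr_powr)

text \<open>Positive semidefiniteness for the points \<open>u powr (-q)\<close> with exponent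
  \<open>1/q\<close>, tested on the coefficients \<open>1 - l\<close>, \<open>-1\<close>,
  \<open>l\<close>; the diagonal entries are the masses themselves.\<close>

lemma powmean_neg_triangle:
  fixes q l r s t :: real
  assumes q: "q > 0" and pos: "r > 0" "s > 0" "t > 0"
  shows "2 * (1 - l) * powmean (-q) r s + 2 * l * powmean (-q) s t
      \<le> (1 - l)\<^sup>2 * r + l\<^sup>2 * t + s + 2 * l * (1 - l) * powmean (-q) r t"
proof -
  define c where "c i = (if i = 0 then 1 - l else if i = 1 then -1 else l)" for i :: nat
  define x where "x i = (if i = 0 then r else if i = 1 then s else t)" for i :: nat
  define M where "M u v = ((u powr (-q) + v powr (-q)) / 2) powr (-(1/q))" for u v
  have M: "M r r = r" "M s s = s" "M t t = t" "M s r = M r s" "M t r = M r t" "M t s = M s t"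
    using assms by (simp_all add: M_def powr_powr add.commute)
  have "0 \<le> (\<Sum>i\<in>{0,1,2}. \<Sum>j\<in>{0,1,2}. c i * c j * M (x i) (x j))"
    unfolding M_def using assms by (intro powr_mean_kernel_psd) (auto simp: x_def)
  also have "\<dots> = (1 - l)\<^sup>2 * r + l\<^sup>2 * t + s + 2 * l * (1 - l) * M r t
      - 2 * (1 - l) * M r s - 2 * l * M s t"
    by (simp add: c_def x_def M) (simp add: algebra_simps power2_eq_square)
  also have "\<dots> = (1 - l)\<^sup>2 * r + l\<^sup>2 * t + s + 2 * l * (1 - l) * powmean (-q) r t
      - 2 * (1 - l) * powmean (-q) r s - 2 * l * powmean (-q) s t"
    using assms by (simp only: M_def powmean_neg)
  finally show ?thesis by simp
qed

lemma powmean_neg_le_geometric: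
  fixes q r t :: real
  assumes "q > 0" "r \<ge> 0" "t \<ge> 0"
  shows "powmean (-q) r t \<le> sqrt (r * t)"
proof (cases "r = 0 \<or> t = 0")
  case True
  then show ?thesis using assms by (auto simp: powmean_def)
next
  case False
  let ?N = "(r powr (-q) + t powr (-q)) / 2"
  have "?N > 0" using False assms by (simp add: add_pos_pos)
  moreover have "(?N powr (-(1/q))) powr (-q) = ?N"
    using \<open>?N > 0\<close> assms by (simp add: powr_powr)
  ultimately show ?thesis
    using False assms powr_mean_neg_le_geometric[of q r t "?N powr (-(1/q))"] by (simp add: powmean_neg)
qed

lemma powmean_neg_nonneg: "q > 0 \<Longrightarrow> powmean (-q) r t \<ge> 0"
  by (simp add: powmean_def)

lemma young_powmean:
  fixes q r t w y :: real
  assumes "q > 0" "r > 0" "t > 0" "w > 0"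
  shows "(q + 1) * w * y - w powr (q + 1) * ((r powr (-q) + t powr (-q)) / 2)
      \<le> q * (powmean (-q) r t * posp y powr ((q + 1) / q))"
proof (cases "y \<ge> 0")
  case True
  then show ?thesis
    using young_powr[of q w "(r powr (-q) + t powr (-q)) / 2" y] assms
    by (simp add: powmean_neg posp_def add_pos_pos)
next
  case False
  \<comment> \<open>For negative \<open>y\<close> the truncation makes the right side vanish, while
    both terms on the left are at most 0.\<close>
  have "(q + 1) * w * y \<le> 0" using False assms by (simp add: mult_nonneg_nonpos)
  moreover have "0 \<le> w powr (q + 1) * ((r powr (-q) + t powr (-q)) / 2)" by simp
  moreover have "posp y = 0" using False by (simp add: posp_def)
  ultimately show ?thesis by (simp only: powr_0 mult_zero_right)
qed

text \<open>The distance-zero inequality bounds the short power means by \<open>E\<close>. Using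
  \<open>w1\<close>, \<open>w2\<close> as test values for these means costs penalty terms, and the
  equations for \<open>w1\<close>, \<open>w2\<close>, \<open>s\<close> are the stationarity
  conditions under which these penalties add up to exactly \<open>E\<close>. The resulting bound
  \<open>q * E + E\<close> is then divided by \<open>q + 1\<close>.\<close>

lemma powr_mean_three_point:
  fixes q l r t w w1 w2 s :: real
  assumes q: "q > 0" and l: "0 < l" "l < 1"
    and pos: "r > 0" "t > 0" "w > 0" "w1 > 0" "w2 > 0" "s > 0"
    and w1: "w1 powr (q + 1) = (1 - l) * r powr (q + 1) + l * w powr (q + 1)"
    and w2: "w2 powr (q + 1) = l * t powr (q + 1) + (1 - l) * w powr (q + 1)"
    and w: "w powr (-q) = (r powr (-q) + t powr (-q)) / 2"
    and s: "s powr (q + 1) = (1 - l) * w1 powr (q + 1) + l * w2 powr (q + 1)"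
  shows "2 * (1 - l) * w1 + 2 * l * w2 \<le> (1 - l)\<^sup>2 * r + l\<^sup>2 * t + s + 2 * l * (1 - l) * w"
proof -
  define R S T where "R = r powr (-q)" and "S = s powr (-q)" and "T = t powr (-q)"
  define W1 W2 where "W1 = w1 powr (q + 1)" and "W2 = w2 powr (q + 1)"
  define E where "E = (1 - l)\<^sup>2 * r + l\<^sup>2 * t + s + 2 * l * (1 - l) * w"
  have *: "x powr (q + 1) * x powr (-q) = x" if "x > 0" for x :: real
    using that by (simp flip: powr_add)
  have young: "(q + 1) * w1 - W1 * ((R + S) / 2) \<le> q * powmean (-q) r s"
      "(q + 1) * w2 - W2 * ((S + T) / 2) \<le> q * powmean (-q) s t"
    using young_powmean[of q r s w1 1] young_powmean[of q s t w2 1] q pos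
    by (simp_all add: R_def S_def T_def W1_def W2_def posp_def)
  have "q * (2 * (1 - l) * powmean (-q) r s + 2 * l * powmean (-q) s t) \<le> q * E"
    using powmean_neg_triangle[of q r s t l] powmean_neg_eqI[OF q pos(1-3) w] q pos
    by (intro mult_left_mono) (auto simp: E_def)
  moreover have "2 * (1 - l) * ((q + 1) * w1 - W1 * ((R + S) / 2)) \<le> 2 * (1 - l) * (q * powmean (-q) r s)"
      "2 * l * ((q + 1) * w2 - W2 * ((S + T) / 2)) \<le> 2 * l * (q * powmean (-q) s t)"
    using young l by (auto intro!: mult_left_mono)
  ultimately have "(q + 1) * (2 * (1 - l) * w1 + 2 * l * w2)
      \<le> q * E + ((1 - l) * W1 * R + l * W2 * T + ((1 - l) * W1 + l * W2) * S)"
    by (simp add: algebra_simps add_divide_distrib diff_divide_distrib)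
  \<comment> \<open>Each product collapses by \<open>x powr (q+1) * x powr (-q) = x\<close>; the two
    mixed terms in \<open>w\<close> combine because \<open>R + T = 2 * w powr (-q)\<close>.\<close>
  also have "(1 - l) * W1 * R + l * W2 * T + ((1 - l) * W1 + l * W2) * S = E"
  proof -
    have "(1 - l) * W1 * R = (1 - l)\<^sup>2 * (r powr (q+1) * R) + l * (1 - l) * (w powr (q+1) * R)"
      unfolding W1_def w1 by (simp add: algebra_simps power2_eq_square)
    moreover have "l * W2 * T = l\<^sup>2 * (t powr (q+1) * T) + l * (1 - l) * (w powr (q+1) * T)"
      unfolding W2_def w2 by (simp add: algebra_simps power2_eq_square)
    moreover have "w powr (q+1) * R + w powr (q+1) * T = 2 * w"
      using *[OF \<open>w > 0\<close>] w by (simp add: R_def T_def algebra_simps add_divide_distrib)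
    then have "l * (1 - l) * (w powr (q+1) * R) + l * (1 - l) * (w powr (q+1) * T) = 2 * l * (1 - l) * w"
      by (simp flip: distrib_left)
    moreover have "((1 - l) * W1 + l * W2) * S = s"
      using *[OF \<open>s > 0\<close>] by (simp add: S_def W1_def W2_def flip: s)
    moreover have "r powr (q+1) * R = r" "t powr (q+1) * T = t"
      using * pos by (auto simp: R_def T_def)
    ultimately show ?thesis by (simp add: E_def)
  qed
  also have "q * E + E = (q + 1) * E" by (simp add: algebra_simps)
  finally show ?thesis using q by (simp add: E_def)
qed

section \<open>The three-point inequality with distances\<close>

text \<open>After inserting the lower bounds for \<open>w1\<close> and \<open>w2\<close>, the terms
  in \<open>l * w * a\<^sup>2\<close> and \<open>(1 - l) * w * b\<^sup>2\<close> cancel. The rest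
  dominates the square of \<open>(1 - l) * sqrt r * a - l * sqrt t * b\<close>, since
  \<open>w\<close> is at most the geometric mean.\<close>

lemma harmonic_weight_bound:
  fixes a b l r t w w1 w2 :: real
  assumes l: "0 < l" "l < 1" and pos: "r > 0" "t > 0" and ab: "a \<ge> 0" "b \<ge> 0"
    and w: "w \<le> sqrt (r * t)"
    and w1: "(1 - l) * r + l * w \<le> w1" and w2: "l * t + (1 - l) * w \<le> w2"
  shows "l * (1 - l) * w * (a + b)\<^sup>2 \<le> (1 - l) * w1 * a\<^sup>2 + l * w2 * b\<^sup>2"
proof -
  have "0 \<le> ((1 - l) * sqrt r * a - l * sqrt t * b)\<^sup>2" by simp
  also have "\<dots> = (1 - l)\<^sup>2 * r * a\<^sup>2 + l\<^sup>2 * t * b\<^sup>2 - 2 * l * (1 - l) * a * b * sqrt (r * t)"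
    using pos by (simp add: power2_diff power_mult_distrib real_sqrt_mult)
  also have "\<dots> \<le> (1 - l)\<^sup>2 * r * a\<^sup>2 + l\<^sup>2 * t * b\<^sup>2 - 2 * l * (1 - l) * a * b * w"
    using w l ab by (intro diff_left_mono mult_left_mono) auto
  finally have "0 \<le> \<dots>" .
  moreover have "(1 - l) * a\<^sup>2 * ((1 - l) * r + l * w) \<le> (1 - l) * a\<^sup>2 * w1"
      "l * b\<^sup>2 * (l * t + (1 - l) * w) \<le> l * b\<^sup>2 * w2"
    using w1 w2 l by (auto intro!: mult_left_mono)
  ultimately show ?thesis by (simp add: algebra_simps power2_eq_square)
qed

text \<open>Linear bookkeeping: \<open>A\<close>, \<open>B\<close>, \<open>C\<close> stand for the
  powers of \<open>w1\<close>, \<open>w2\<close>, \<open>w\<close>, while \<open>E\<close> and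
  \<open>G\<close> collect the minimising and the given masses. The terms in \<open>A\<close> and
  \<open>B\<close> cancel, and those in \<open>C\<close> form the penalty of the long side.\<close>

lemma combine_variational_bounds:
  fixes q l :: real
  assumes q: "q > 0" and l: "0 < l" "l < 1"
    and K12: "q * K12 = (q + 1) * w1 * y1 - A * ((R + S) / 2)"
    and K23: "q * K23 = (q + 1) * w2 * y2 - B * ((S + T) / 2)"
    and K13: "(q + 1) * w * y3 - C * ((R + T) / 2) \<le> q * K13"
    and main: "2 * (1 - l) * w1 * y1 + 2 * l * w2 * y2 \<le> E + 2 * l * (1 - l) * (w * y3)"
    and E: "(q + 1) * E \<le> q * G + (1 - l) * (A - l * C) * R
      + l * (B - (1 - l) * C) * T + ((1 - l) * A + l * B) * S"
  shows "2 * (1 - l) * K12 + 2 * l * K23 \<le> G + 2 * l * (1 - l) * K13"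
proof -
  have "q * (2 * (1 - l) * K12 + 2 * l * K23) = 2 * (1 - l) * (q * K12) + 2 * l * (q * K23)"
    by (simp add: algebra_simps)
  also have "\<dots> = (q + 1) * (2 * (1 - l) * w1 * y1 + 2 * l * w2 * y2)
       - (1 - l) * A * (R + S) - l * B * (S + T)"
    unfolding K12 K23 by (simp add: field_simps)
  also have "\<dots> \<le> (q + 1) * (E + 2 * l * (1 - l) * (w * y3)) - (1 - l) * A * (R + S) - l * B * (S + T)"
    using q by (intro diff_right_mono mult_left_mono main) simp
  also have "\<dots> = (q + 1) * E + 2 * l * (1 - l) * ((q + 1) * w * y3) - (1 - l) * A * (R + S) - l * B * (S + T)"
    by (simp add: algebra_simps)
  also have "\<dots> \<le> q * G + (1 - l) * (A - l * C) * R + l * (B - (1 - l) * C) * T + ((1 - l) * A + l * B) * S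
      + 2 * l * (1 - l) * ((q + 1) * w * y3) - (1 - l) * A * (R + S) - l * B * (S + T)"
    by (intro diff_right_mono add_right_mono E)
  also have "\<dots> = q * G + 2 * l * (1 - l) * ((q + 1) * w * y3 - C * ((R + T) / 2))"
    by (simp add: field_simps)
  also have "\<dots> \<le> q * G + 2 * l * (1 - l) * (q * K13)"
    by (intro add_left_mono mult_left_mono K13) (use l in simp)
  also have "\<dots> = q * (G + 2 * l * (1 - l) * K13)"
    by (simp add: algebra_simps)
  finally show ?thesis using q by (rule mult_left_le_imp_le)
qed

text \<open>The strict bounds on \<open>a\<close> and \<open>b\<close> give both short sides
  positive maximisers \<open>w1\<close>, \<open>w2\<close>. The long side enters with a positive
  coefficient, so a lower bound for \<open>y\<close> and an arbitrary test value \<open>w\<close>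
  suffice there.\<close>

lemma cone_kernel_triangle_pos:
  fixes q l r s t a b y :: real
  assumes q: "q > 0" and l: "0 < l" "l < 1" and pos: "r > 0" "s > 0" "t > 0"
    and ab: "a \<ge> 0" "b \<ge> 0" "a\<^sup>2 < 1" "b\<^sup>2 < 1" and y: "1 - (a + b)\<^sup>2 \<le> y"
  shows "2 * (1 - l) * (powmean (-q) r s * posp (1 - a\<^sup>2) powr ((q + 1) / q))
       + 2 * l * (powmean (-q) s t * posp (1 - b\<^sup>2) powr ((q + 1) / q))
      \<le> (1 - l)\<^sup>2 * r + l\<^sup>2 * t + s + 2 * l * (1 - l) * (powmean (-q) r t * posp y powr ((q + 1) / q))"
    (is "2 * (1 - l) * ?K12 + 2 * l * ?K23 \<le> _ + 2 * l * (1 - l) * ?K13")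
proof -
  define R S T where "R = r powr (-q)" and "S = s powr (-q)" and "T = t powr (-q)"
  have RST: "(R + S) / 2 > 0" "(S + T) / 2 > 0" using pos by (auto simp: R_def S_def T_def add_pos_pos)
  obtain w1 where w1: "w1 > 0" and K12: "q * ?K12 = (q + 1) * w1 * (1 - a\<^sup>2) - w1 powr (q + 1) * ((R + S) / 2)"
    using young_powr_attained[OF q RST(1), of "1 - a\<^sup>2"] ab q pos
    by (auto simp: powmean_neg posp_def R_def S_def)
  obtain w2 where w2: "w2 > 0" and K23: "q * ?K23 = (q + 1) * w2 * (1 - b\<^sup>2) - w2 powr (q + 1) * ((S + T) / 2)"
    using young_powr_attained[OF q RST(2), of "1 - b\<^sup>2"] ab q pos
    by (auto simp: powmean_neg posp_def S_def T_def)
  obtain r' t' w where pos': "r' > 0" "t' > 0" "w > 0"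
    and W1: "w1 powr (q + 1) = (1 - l) * r' powr (q + 1) + l * w powr (q + 1)"
    and W2: "w2 powr (q + 1) = l * t' powr (q + 1) + (1 - l) * w powr (q + 1)"
    and W: "w powr (-q) = (r' powr (-q) + t' powr (-q)) / 2"
    using balanced_split_powr[OF q l w1 w2] .
  define s' where "s' = ((1 - l) * w1 powr (q + 1) + l * w2 powr (q + 1)) powr (1 / (q + 1))"
  have sum_pos: "(1 - l) * w1 powr (q + 1) + l * w2 powr (q + 1) > 0"
    using l w1 w2 by (simp add: add_pos_pos)
  have s': "s' > 0" "s' powr (q + 1) = (1 - l) * w1 powr (q + 1) + l * w2 powr (q + 1)"
    using sum_pos q by (auto simp: s'_def powr_powr)
  \<comment> \<open>\<open>r', s', t'\<close> are the masses minimising the quadratic form once the values \<open>w1, w2, w\<close>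
    are fixed.\<close>
  define E where "E = (1 - l)\<^sup>2 * r' + l\<^sup>2 * t' + s'"
  have K13: "(q + 1) * w * (1 - (a + b)\<^sup>2) - w powr (q + 1) * ((R + T) / 2) \<le> q * ?K13"
  proof -
    have "(q + 1) * w * (1 - (a + b)\<^sup>2) \<le> (q + 1) * w * y"
      using q pos' y by (intro mult_left_mono) auto
    then show ?thesis using young_powmean[of q r t w y] q pos pos' unfolding R_def T_def by linarith
  qed
  have "2 * (1 - l) * w1 + 2 * l * w2 \<le> E + 2 * l * (1 - l) * w"
    using powr_mean_three_point[OF q l pos' w1 w2 s'(1) W1 W2 W s'(2)] by (simp add: E_def)
  moreover have "l * (1 - l) * w * (a + b)\<^sup>2 \<le> (1 - l) * w1 * a\<^sup>2 + l * w2 * b\<^sup>2"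
  proof (rule harmonic_weight_bound[OF l pos'(1,2) ab(1,2)])
    show "w \<le> sqrt (r' * t')" using powr_mean_neg_le_geometric[OF q pos' W] .
    show "(1 - l) * r' + l * w \<le> w1"
      using powr_mean_ge_arithmetic[of "q + 1" l r' w w1] q l pos' w1 W1 by simp
    show "l * t' + (1 - l) * w \<le> w2"
      using powr_mean_ge_arithmetic[of "q + 1" "1 - l" t' w w2] q l pos' w2 W2 by simp
  qed
  ultimately have main: "2 * (1 - l) * w1 * (1 - a\<^sup>2) + 2 * l * w2 * (1 - b\<^sup>2)
      \<le> E + 2 * l * (1 - l) * (w * (1 - (a + b)\<^sup>2))"
    by (simp add: algebra_simps)
  define A B C where "A = w1 powr (q + 1)" and "B = w2 powr (q + 1)" and "C = w powr (q + 1)"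
  define G where "G = (1 - l)\<^sup>2 * r + l\<^sup>2 * t + s"
  \<comment> \<open>The estimates \<open>Er\<close>, \<open>Et\<close>, \<open>Es\<close> pass from
    the minimising masses to the given ones; the split equations rewrite the powers of
    \<open>r'\<close>, \<open>t'\<close>, \<open>s'\<close> as the coefficients of \<open>R\<close>,
    \<open>T\<close>, \<open>S\<close>.\<close>
  have "(1 - l)\<^sup>2 * ((q + 1) * r') \<le> (1 - l)\<^sup>2 * (q * r + r' powr (q + 1) * R)"
    using young_powr_neg[of q r r'] q pos pos' by (intro mult_left_mono) (auto simp: R_def)
  moreover have "(1 - l)\<^sup>2 * (r' powr (q + 1) * R) = (1 - l) * (A - l * C) * R"
    unfolding A_def C_def W1 by (simp add: algebra_simps power2_eq_square)
  ultimately have Er: "(q + 1) * ((1 - l)\<^sup>2 * r') \<le> q * ((1 - l)\<^sup>2 * r) + (1 - l) * (A - l * C) * R"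
    unfolding distrib_left by (simp only: mult.left_commute)
  have "l\<^sup>2 * ((q + 1) * t') \<le> l\<^sup>2 * (q * t + t' powr (q + 1) * T)"
    using young_powr_neg[of q t t'] q pos pos' by (intro mult_left_mono) (auto simp: T_def)
  moreover have "l\<^sup>2 * (t' powr (q + 1) * T) = l * (B - (1 - l) * C) * T"
    unfolding B_def C_def W2 by (simp add: algebra_simps power2_eq_square)
  ultimately have Et: "(q + 1) * (l\<^sup>2 * t') \<le> q * (l\<^sup>2 * t) + l * (B - (1 - l) * C) * T"
    unfolding distrib_left by (simp only: mult.left_commute)
  have Es: "(q + 1) * s' \<le> q * s + ((1 - l) * A + l * B) * S"
    using young_powr_neg[of q s s'] q pos s'(1) unfolding A_def B_def S_def s'(2)[symmetric] by simp
  have E: "(q + 1) * E \<le> q * G + (1 - l) * (A - l * C) * R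
      + l * (B - (1 - l) * C) * T + ((1 - l) * A + l * B) * S"
    using Er Et Es unfolding E_def G_def distrib_left[of _ "_ + _"] distrib_left[of "q + 1" "(1 - l)\<^sup>2 * r'"]
      distrib_left[of "q" "(1 - l)\<^sup>2 * r"] by linarith
  show ?thesis
    by (rule combine_variational_bounds[OF q l K12 K23 K13 main E[unfolded A_def B_def C_def G_def]])
qed

section \<open>Vanishing masses and large distances\<close>

lemma cone_kernel_bounds:
  fixes q r t y :: real
  assumes "q > 0" "r \<ge> 0" "t \<ge> 0" "y \<le> 1"
  shows "0 \<le> powmean (-q) r t * posp y powr ((q + 1) / q)"
    and "powmean (-q) r t * posp y powr ((q + 1) / q) \<le> sqrt (r * t)"
proof -
  have M: "0 \<le> powmean (-q) r t" "powmean (-q) r t \<le> sqrt (r * t)"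
    using assms powmean_neg_nonneg powmean_neg_le_geometric by auto
  have f: "posp y powr ((q + 1) / q) \<le> 1"
    using assms by (intro powr_le1) (auto simp: posp_def)
  show "0 \<le> powmean (-q) r t * posp y powr ((q + 1) / q)" using M by simp
  show "powmean (-q) r t * posp y powr ((q + 1) / q) \<le> sqrt (r * t)"
    using mult_mono[OF M(2) f] M assms by simp
qed

lemma two_mult_sqrt_le:
  fixes l s t :: real
  assumes "s \<ge> 0" "t \<ge> 0"
  shows "2 * l * sqrt (s * t) \<le> l\<^sup>2 * t + s"
proof -
  have "0 \<le> (l * sqrt t - sqrt s)\<^sup>2" by simp
  then show ?thesis
    using assms by (simp add: power2_diff power_mult_distrib real_sqrt_mult mult_ac)
qed

text \<open>In the degenerate cases one short-side kernel vanishes, and the other is bounded by the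
  geometric mean, so completing a square is enough.\<close>

lemma cone_kernel_triangle:
  fixes q l r s t a b y :: real
  assumes q: "q > 0" and l: "0 < l" "l < 1" and pos: "r \<ge> 0" "s \<ge> 0" "t \<ge> 0"
    and ab: "a \<ge> 0" "b \<ge> 0" and y: "1 - (a + b)\<^sup>2 \<le> y" "y \<le> 1"
  shows "2 * (1 - l) * (powmean (-q) r s * posp (1 - a\<^sup>2) powr ((q + 1) / q))
       + 2 * l * (powmean (-q) s t * posp (1 - b\<^sup>2) powr ((q + 1) / q))
      \<le> (1 - l)\<^sup>2 * r + l\<^sup>2 * t + s + 2 * l * (1 - l) * (powmean (-q) r t * posp y powr ((q + 1) / q))"
    (is "2 * (1 - l) * ?K12 + 2 * l * ?K23 \<le> _ + 2 * l * (1 - l) * ?K13")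
proof -
  have K13: "2 * l * (1 - l) * ?K13 \<ge> 0"
    using cone_kernel_bounds(1)[OF q pos(1,3) y(2)] l by simp
  consider "r = 0 \<or> s = 0 \<or> a\<^sup>2 \<ge> 1" | "s = 0 \<or> t = 0 \<or> b\<^sup>2 \<ge> 1"
    | "r > 0" "s > 0" "t > 0" "a\<^sup>2 < 1" "b\<^sup>2 < 1" using pos by linarith
  then show ?thesis
  proof cases
    case 1
    then have K12: "?K12 = 0" using q by (auto simp: powmean_def posp_def)
    have "0 \<le> (1 - l)\<^sup>2 * r" using pos by simp
    have "2 * l * ?K23 \<le> 2 * l * sqrt (s * t)"
      using cone_kernel_bounds(2)[OF q pos(2,3), of "1 - b\<^sup>2"] l by (intro mult_left_mono) auto
    also have "\<dots> \<le> l\<^sup>2 * t + s" using pos by (intro two_mult_sqrt_le)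
    finally show ?thesis unfolding K12 using K13 \<open>0 \<le> (1 - l)\<^sup>2 * r\<close> by linarith
  next
    case 2
    then have K23: "?K23 = 0" using q by (auto simp: powmean_def posp_def)
    have "2 * (1 - l) * ?K12 \<le> 2 * (1 - l) * sqrt (s * r)"
      using cone_kernel_bounds(2)[OF q pos(1,2), of "1 - a\<^sup>2"] l
      by (intro mult_left_mono) (auto simp: mult.commute)
    also have "\<dots> \<le> (1 - l)\<^sup>2 * r + s" using pos by (intro two_mult_sqrt_le)
    moreover have "0 \<le> l\<^sup>2 * t" using pos by simp
    ultimately show ?thesis unfolding K23 using K13 by linarith
  next
    case 3
    then show ?thesis by (intro cone_kernel_triangle_pos q l ab y)
  qed
qed

section \<open>From weighted inequalities to square roots\<close>

text \<open>For positive \<open>u\<close>, \<open>v\<close>, the minimum of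
  \<open>u\<^sup>2 / l + v\<^sup>2 / (1 - l)\<close> over \<open>0 < l < 1\<close> is
  \<open>(u + v)\<^sup>2\<close>, attained at \<open>l = u / (u + v)\<close>.\<close>

lemma sqrt_triangle_of_weighted:
  fixes A B C :: real
  assumes A: "A \<ge> 0" and B: "B \<ge> 0"
    and weighted: "\<And>l. 0 < l \<Longrightarrow> l < 1 \<Longrightarrow> l * (1 - l) * C \<le> (1 - l) * A + l * B"
  shows "sqrt C \<le> sqrt A + sqrt B"
proof (rule field_le_epsilon)
  fix e :: real assume "e > 0"
  \<comment> \<open>The shift by \<open>e / 2\<close> keeps \<open>l\<close> strictly inside the
    unit interval even when \<open>A\<close> or \<open>B\<close> is zero.\<close>
  define u v where "u = sqrt A + e / 2" and "v = sqrt B + e / 2"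
  have uv: "u > 0" "v > 0" using A B \<open>e > 0\<close> by (auto simp: u_def v_def add_nonneg_pos)
  have "A \<le> u\<^sup>2" "B \<le> v\<^sup>2"
    using \<open>e > 0\<close> by (auto simp: u_def v_def intro!: sqrt_le_D)
  define l where "l = u / (u + v)"
  have l: "0 < l" "l < 1" and uv_eq: "(1 - l) * u\<^sup>2 + l * v\<^sup>2 = l * (1 - l) * (u + v)\<^sup>2"
  proof -
    show "0 < l" "l < 1" using uv by (auto simp: l_def)
    have "u = l * (u + v)" "v = (1 - l) * (u + v)" using uv by (auto simp: l_def field_simps)
    then have "u\<^sup>2 = l\<^sup>2 * (u + v)\<^sup>2" "v\<^sup>2 = (1 - l)\<^sup>2 * (u + v)\<^sup>2" by (metis power_mult_distrib)+
    then show "(1 - l) * u\<^sup>2 + l * v\<^sup>2 = l * (1 - l) * (u + v)\<^sup>2" by algebra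
  qed
  have "l * (1 - l) * C \<le> (1 - l) * A + l * B"
    using l by (rule weighted)
  also have "\<dots> \<le> (1 - l) * u\<^sup>2 + l * v\<^sup>2"
    using l \<open>A \<le> u\<^sup>2\<close> \<open>B \<le> v\<^sup>2\<close> by (intro add_mono mult_left_mono) auto
  finally have "C \<le> (u + v)\<^sup>2"
    unfolding uv_eq using l by (simp add: mult_le_cancel_left_pos)
  then have "sqrt C \<le> u + v" using uv by (intro real_le_lsqrt) auto
  then show "sqrt C \<le> sqrt A + sqrt B + e" by (simp add: u_def v_def)
qed

section \<open>Zeros of the cost and the triangle inequality for p > 1\<close>

lemma powmean_one: "r \<ge> 0 \<Longrightarrow> t \<ge> 0 \<Longrightarrow> powmean 1 r t = (r + t) / 2"
  by (simp add: powmean_def)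

lemma Hp_gt1:
  assumes "q > 0" "r \<ge> 0" "t \<ge> 0"
  shows "Hp (1 + q) x1 r x2 t = 2 / (1 + q) *
    ((r + t) / 2 - powmean (-q) r t * posp (1 - (sqrt (q / 2) * dist x1 x2)\<^sup>2) powr ((q + 1) / q))"
  using assms by (simp add: Hp_def powmean_one power_mult_distrib add.commute)

text \<open>A common form for \<open>p = 1\<close> and \<open>p > 1\<close>: \<open>m\<close> is a
  mean of the masses below the geometric one, and \<open>f\<close> is a damping factor that equals 1
  only at distance zero.\<close>

lemma Hp_factorization:
  fixes x1 x2 :: "'a::metric_space"
  assumes p: "p \<ge> 1" and "r \<ge> 0" "t \<ge> 0"
  obtains m f where "Hp p x1 r x2 t = 2 / p * ((r + t) / 2 - m * f)"
    "0 \<le> m" "m \<le> sqrt (r * t)" "0 \<le> f" "f \<le> 1" "f = 1 \<longleftrightarrow> x1 = x2" "r = t \<Longrightarrow> m = r"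
proof (cases "p = 1")
  case True
  show thesis
    by (rule that[of "sqrt (r * t)" "exp (- (dist x1 x2)\<^sup>2 / 2)"])
       (use True assms in \<open>auto simp: Hp_def powmean_def\<close>)
next
  case False
  define q where "q = p - 1"
  have q: "q > 0" and p_eq: "p = 1 + q" using False p by (auto simp: q_def)
  define y where "y = posp (1 - (sqrt (q / 2) * dist x1 x2)\<^sup>2)"
  have y: "0 \<le> y" "y \<le> 1" by (auto simp: y_def posp_def)
  have y1: "y = 1 \<longleftrightarrow> x1 = x2" using q by (auto simp: y_def posp_def max_def)
  have f1: "y powr ((q + 1) / q) = 1 \<longleftrightarrow> y = 1"
  proof
    assume *: "y powr ((q + 1) / q) = 1"
    show "y = 1"
    proof (rule ccontr)
      assume "y \<noteq> 1"
      then have "y powr ((q + 1) / q) < 1 powr ((q + 1) / q)" using y q by (intro powr_less_mono2) auto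
      then show False using * by simp
    qed
  qed simp
  show thesis
  proof (rule that[of "powmean (-q) r t" "y powr ((q + 1) / q)"])
    show "Hp p x1 r x2 t = 2 / p * ((r + t) / 2 - powmean (- q) r t * y powr ((q + 1) / q))"
      unfolding p_eq y_def using q assms by (intro Hp_gt1)
    show "r = t \<Longrightarrow> powmean (- q) r t = r"
      using q assms by (cases "r = 0") (auto simp: powmean_def powr_powr)
    show "y powr ((q + 1) / q) \<le> 1" using y q by (intro powr_le1) auto
  qed (use q assms y1 f1 in \<open>auto simp: powmean_neg_nonneg powmean_neg_le_geometric\<close>)
qed

text \<open>The chain \<open>m * f \<le> sqrt (r * t) \<le> (r + t) / 2\<close> gives the sign.
  Equality in AM-GM forces \<open>r = t\<close>, and then \<open>r = r * f\<close> leaves only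
  \<open>r = 0\<close> or coinciding points.\<close>

lemma
  fixes x1 x2 :: "'a::metric_space"
  assumes p: "p \<ge> 1" and rt: "r \<ge> 0" "t \<ge> 0"
  shows Hp_nonneg: "Hp p x1 r x2 t \<ge> 0"
    and Hp_eq_0_iff: "Hp p x1 r x2 t = 0 \<longleftrightarrow> cone_eq x1 r x2 t"
proof -
  obtain m f where H: "Hp p x1 r x2 t = 2 / p * ((r + t) / 2 - m * f)"
    and m: "0 \<le> m" "m \<le> sqrt (r * t)" "r = t \<Longrightarrow> m = r"
    and f: "0 \<le> f" "f \<le> 1" "f = 1 \<longleftrightarrow> x1 = x2"
    using Hp_factorization[OF assms] by metis
  have le: "m * f \<le> sqrt (r * t)" using mult_mono[OF m(2) f(2)] m f rt by simp
  also have amgm: "sqrt (r * t) \<le> (r + t) / 2" using rt by (rule arith_geo_mean_sqrt)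
  finally show "Hp p x1 r x2 t \<ge> 0" using p by (simp add: H)
  show "Hp p x1 r x2 t = 0 \<longleftrightarrow> cone_eq x1 r x2 t"
  proof
    assume "Hp p x1 r x2 t = 0"
    then have eq: "(r + t) / 2 = m * f" using p by (simp add: H)
    then have "sqrt (r * t) = (r + t) / 2" using le amgm by simp
    then have "r * t = ((r + t) / 2)\<^sup>2" using rt by (metis mult_nonneg_nonneg real_sqrt_pow2)
    then have "(r - t)\<^sup>2 = 0" by (simp add: power2_eq_square field_simps)
    then have "r = t" by simp
    then have "r = r * f" using eq m(3) by simp
    then show "cone_eq x1 r x2 t" using \<open>r = t\<close> f(3) by (auto simp: cone_eq_def)
  next
    assume "cone_eq x1 r x2 t"
    then show "Hp p x1 r x2 t = 0" using m f(3) by (auto simp: H cone_eq_def)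
  qed
qed

lemma Hp_triangle_gt1:
  fixes x1 x2 x3 :: "'a::metric_space"
  assumes q: "q > 0" and pos: "r \<ge> 0" "s \<ge> 0" "t \<ge> 0"
  shows "sqrt (Hp (1 + q) x1 r x3 t) \<le> sqrt (Hp (1 + q) x1 r x2 s) + sqrt (Hp (1 + q) x2 s x3 t)"
proof (rule sqrt_triangle_of_weighted)
  show "Hp (1 + q) x1 r x2 s \<ge> 0" "Hp (1 + q) x2 s x3 t \<ge> 0"
    using q pos by (auto intro!: Hp_nonneg)
  fix l :: real assume l: "0 < l" "l < 1"
  define a b c where "a = sqrt (q / 2) * dist x1 x2" and "b = sqrt (q / 2) * dist x2 x3"
    and "c = sqrt (q / 2) * dist x1 x3"
  have ab: "a \<ge> 0" "b \<ge> 0" "c \<ge> 0" using q by (auto simp: a_def b_def c_def)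
  have "c \<le> a + b"
    using mult_left_mono[OF dist_triangle[of x1 x3 x2], of "sqrt (q / 2)"] q
    by (simp add: a_def b_def c_def distrib_left)
  then have c: "1 - (a + b)\<^sup>2 \<le> 1 - c\<^sup>2" using ab by (simp add: power_mono)
  define K12 K23 K13 where "K12 = powmean (-q) r s * posp (1 - a\<^sup>2) powr ((q + 1) / q)"
    and "K23 = powmean (-q) s t * posp (1 - b\<^sup>2) powr ((q + 1) / q)"
    and "K13 = powmean (-q) r t * posp (1 - c\<^sup>2) powr ((q + 1) / q)"
  have "2 * (1 - l) * K12 + 2 * l * K23 \<le> (1 - l)\<^sup>2 * r + l\<^sup>2 * t + s + 2 * l * (1 - l) * K13"
    unfolding K12_def K23_def K13_def
    by (rule cone_kernel_triangle[OF q l pos ab(1,2) c]) simp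
  \<comment> \<open>The weighted arithmetic means combine to half of
    \<open>(1 - l)\<^sup>2 * r + l\<^sup>2 * t + s\<close>.\<close>
  then have "l * (1 - l) * ((r + t) / 2 - K13) \<le> (1 - l) * ((r + s) / 2 - K12) + l * ((s + t) / 2 - K23)"
    by (simp add: field_simps power2_eq_square)
  then have "2 / (1 + q) * (l * (1 - l) * ((r + t) / 2 - K13))
      \<le> 2 / (1 + q) * ((1 - l) * ((r + s) / 2 - K12) + l * ((s + t) / 2 - K23))"
    using q by (intro mult_left_mono) auto
  moreover have "Hp (1 + q) x1 r x3 t = 2 / (1 + q) * ((r + t) / 2 - K13)"
      "Hp (1 + q) x1 r x2 s = 2 / (1 + q) * ((r + s) / 2 - K12)"
      "Hp (1 + q) x2 s x3 t = 2 / (1 + q) * ((s + t) / 2 - K23)"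
    unfolding K12_def K23_def K13_def a_def b_def c_def
    using Hp_gt1[OF q pos(1,3)] Hp_gt1[OF q pos(1,2)] Hp_gt1[OF q pos(2,3)] by blast+
  ultimately show "l * (1 - l) * Hp (1 + q) x1 r x3 t \<le> (1 - l) * Hp (1 + q) x1 r x2 s + l * Hp (1 + q) x2 s x3 t"
    by (simp only: distrib_left mult.left_commute)
qed

section \<open>The limit case p = 1\<close>

lemma tendsto_powmean_neg:
  fixes r t :: real
  assumes "r \<ge> 0" "t \<ge> 0"
  shows "((\<lambda>q. powmean (-q) r t) \<longlongrightarrow> sqrt (r * t)) (at_right 0)"
proof (cases "r = 0 \<or> t = 0")
  case True
  have "\<forall>\<^sub>F q :: real in at_right 0. powmean (-q) r t = sqrt (r * t)"
    using eventually_at_right_less[of "0 :: real"] by eventually_elim (use True in \<open>auto simp: powmean_def\<close>)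
  then show ?thesis by (rule tendsto_eventually)
next
  case False
  then have "r > 0" "t > 0" using assms by auto
  then have "((\<lambda>q. ((r powr (-q) + t powr (-q)) / 2) powr (-(1/q))) \<longlongrightarrow> exp (- ((- ln r - ln t) / 2))) (at_right 0)"
    by real_asymp
  also have "exp (- ((- ln r - ln t) / 2)) = exp (ln (r * t) / 2)"
    using \<open>r > 0\<close> \<open>t > 0\<close> by (simp add: ln_mult add_divide_distrib diff_divide_distrib)
  also have "\<dots> = sqrt (r * t)"
    using \<open>r > 0\<close> \<open>t > 0\<close> by (simp add: powr_half_sqrt[symmetric] powr_def)
  finally show ?thesis
    by (rule Lim_transform_eventually)
       (use eventually_at_right_less[of "0 :: real"] \<open>r > 0\<close> \<open>t > 0\<close>
         in \<open>auto elim!: eventually_mono simp: powmean_neg\<close>)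
qed

lemma tendsto_Hp_1:
  fixes x1 x2 :: "'a::metric_space"
  assumes "r \<ge> 0" "t \<ge> 0"
  shows "((\<lambda>q. Hp (1 + q) x1 r x2 t) \<longlongrightarrow> Hp 1 x1 r x2 t) (at_right 0)"
proof -
  define D where "D = (dist x1 x2)\<^sup>2"
  have "((\<lambda>q. (1 - q * D / 2) powr ((q + 1) / q)) \<longlongrightarrow> exp (-D / 2)) (at_right 0)"
    by real_asymp
  then have "((\<lambda>q. 2 / (1 + q) * ((r + t) / 2 - powmean (-q) r t * (1 - q * D / 2) powr ((q + 1) / q)))
      \<longlongrightarrow> 2 / (1 + 0) * ((r + t) / 2 - sqrt (r * t) * exp (-D / 2))) (at_right 0)"
    by (intro tendsto_intros tendsto_powmean_neg assms) auto
  also have "2 / (1 + 0) * ((r + t) / 2 - sqrt (r * t) * exp (-D / 2)) = Hp 1 x1 r x2 t"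
    using assms by (simp add: Hp_def powmean_def D_def)
  finally show ?thesis
  proof (rule Lim_transform_eventually)
    \<comment> \<open>For \<open>q\<close> close to 0 the argument of \<open>posp\<close> is
      positive, so the truncation disappears near the limit.\<close>
    have "((\<lambda>q. 1 - q * D / 2) \<longlongrightarrow> 1 - 0 * D / 2) (at_right 0)" by (intro tendsto_intros) simp
    then have "\<forall>\<^sub>F q in at_right 0. 0 < 1 - q * D / 2" by (rule order_tendstoD) simp
    then show "\<forall>\<^sub>F q in at_right 0. 2 / (1 + q) * ((r + t) / 2 - powmean (-q) r t * (1 - q * D / 2) powr ((q + 1) / q))
        = Hp (1 + q) x1 r x2 t"
      using eventually_at_right_less[of "0 :: real"]
    proof eventually_elim
      case (elim q)
      have "posp (1 - (sqrt (q / 2) * dist x1 x2)\<^sup>2) = 1 - q * D / 2"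
        using elim by (simp add: posp_def D_def power_mult_distrib)
      then show ?case using elim assms by (simp add: Hp_gt1)
    qed
  qed
qed

lemma Hp_triangle:
  fixes x1 x2 x3 :: "'a::metric_space"
  assumes p: "p \<ge> 1" and pos: "r \<ge> 0" "s \<ge> 0" "t \<ge> 0"
  shows "sqrt (Hp p x1 r x3 t) \<le> sqrt (Hp p x1 r x2 s) + sqrt (Hp p x2 s x3 t)"
proof (cases "p = 1")
  case True
  have "sqrt (Hp 1 x1 r x3 t) \<le> sqrt (Hp 1 x1 r x2 s) + sqrt (Hp 1 x2 s x3 t)"
  proof (rule tendsto_le)
    show "((\<lambda>q. sqrt (Hp (1 + q) x1 r x3 t)) \<longlongrightarrow> sqrt (Hp 1 x1 r x3 t)) (at_right 0)"
      by (intro tendsto_real_sqrt tendsto_Hp_1 pos)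
    show "((\<lambda>q. sqrt (Hp (1 + q) x1 r x2 s) + sqrt (Hp (1 + q) x2 s x3 t))
        \<longlongrightarrow> sqrt (Hp 1 x1 r x2 s) + sqrt (Hp 1 x2 s x3 t)) (at_right 0)"
      by (intro tendsto_add tendsto_real_sqrt tendsto_Hp_1 pos)
    show "\<forall>\<^sub>F q in at_right 0. sqrt (Hp (1 + q) x1 r x3 t)
        \<le> sqrt (Hp (1 + q) x1 r x2 s) + sqrt (Hp (1 + q) x2 s x3 t)"
      using eventually_at_right_less[of "0 :: real"]
      by eventually_elim (rule Hp_triangle_gt1[OF _ pos])
  qed simp
  then show ?thesis using True by simp
next
  case False
  then show ?thesis using Hp_triangle_gt1[OF _ pos, of "p - 1" x1 x3 x2] p by simp
qed

section \<open>Invariance, symmetry and conclusion\<close>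

text \<open>When a mass is zero, the power mean in front of the distance factor vanishes, so the
  position of that point has no influence.\<close>

lemma Hp_cong:
  assumes "p \<ge> 1" "cone_eq x1 r x1' r'" "cone_eq x2 t x2' t'"
  shows "Hp p x1 r x2 t = Hp p x1' r' x2' t'"
  using assms by (auto simp: Hp_def powmean_def cone_eq_def)

lemma Hp_commute: "Hp p x1 r x2 t = Hp p x2 t x1 r"
proof -
  have "powmean m r t = powmean m t r" for m
    by (auto simp: powmean_def add.commute mult.commute)
  then show ?thesis by (simp add: Hp_def dist_commute)
qed

theorem mainTheorem14:
  fixes p :: real
  assumes "p \<ge> 1"
  shows
    "(\<forall>(x1::'a::metric_space) r x1' r' x2 t x2' t'.
        r \<ge> 0 \<and> r' \<ge> 0 \<and> t \<ge> 0 \<and> t' \<ge> 0 \<and>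
        cone_eq x1 r x1' r' \<and> cone_eq x2 t x2' t' \<longrightarrow>
        Hp p x1 r x2 t = Hp p x1' r' x2' t')
   \<and> (\<forall>(x1::'a) r x2 t. r \<ge> 0 \<and> t \<ge> 0 \<longrightarrow> Hp p x1 r x2 t \<ge> 0)
   \<and> (\<forall>(x1::'a) r x2 t. r \<ge> 0 \<and> t \<ge> 0 \<longrightarrow>
        (Hp p x1 r x2 t = 0 \<longleftrightarrow> cone_eq x1 r x2 t))
   \<and> (\<forall>(x1::'a) r x2 t. r \<ge> 0 \<and> t \<ge> 0 \<longrightarrow> Hp p x1 r x2 t = Hp p x2 t x1 r)
   \<and> (\<forall>(x1::'a) x2 x3 r s t. r \<ge> 0 \<and> s \<ge> 0 \<and> t \<ge> 0 \<longrightarrow>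
        sqrt (Hp p x1 r x3 t) \<le> sqrt (Hp p x1 r x2 s) + sqrt (Hp p x2 s x3 t))"
proof (intro conjI allI impI, goal_cases)
  case 1
  then show ?case by (intro Hp_cong[OF assms]) auto
next
  case 2
  then show ?case by (intro Hp_nonneg[OF assms]) auto
next
  case 3
  then show ?case by (intro Hp_eq_0_iff[OF assms]) auto
next
  case 4
  show ?case by (rule Hp_commute)
next
  case 5
  then show ?case by (intro Hp_triangle[OF assms]) auto
qed

end
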